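(* For every choice of data $(m,n,(a_i),(b_j),(c_{ij}))$ of the transportation problem, the algorithm described in the context always terminates after a finite number of cycles (whatever arbitrary choices are made in it). When it has terminated, define $f_{ij}$ to be the force associated with the edge between $A_i$ and $B_j$ if there is such an edge in the final graph, and $f_{ij}=0$ otherwise. Then $(f_{ij})$ is an optimal solution of the transportation problem.
   Context: Transportation problem: given integers $m,n\ge1$, real $a_i\ge 0$ ($1\le i\le m$), $b_j\ge 0$ ($1\le j\le n$) with $\sum_i a_i=\sum_j b_j$, and an arbitrary real matrix $(c_{ij})$, maximize $\sum_i\sum_j c_{ij}f_{ij}$ subject to $\sum_j f_{ij}=a_i$ for all $i$, $\sum_i f_{ij}=b_j$ for all $j$, $f_{ij}\ge0$. A maximizer among the matrices satisfying these constraints is an optimal solution. Algorithm. It operates on a graph with the fixed set of $m+n+2$ nodes $A_1,\dots,A_m,B_1,\dots,B_n,P,Q$ and a varying set of edges, a variable real number $\alpha_i$ for each $A_i$, a variable real number $\beta_j$ for each $B_j$, and a variable real number called force for each edge. Put $\gamma_{ij}=\alpha_i-\beta_j-c_{ij}$. At the beginning of each cycle the graph is a forest consisting of two trees: the moving tree $T_m$, containing $Q$, and the fixed tree $T_f$, containing $P$. Step 1 (Initialize; executed once). The edges are: an edge between $Q$ and each $A_i$, with force $a_i$, and an edge between $P$ and each $B_j$, with force $b_j$. Set $\alpha_i=c_{\rm sup}$ for all $i$, where $c_{\rm sup}>\max_{i,j}c_{ij}$, and $\beta_j=0$ for all $j$. Then Steps 2 to 5 are repeated; each execution of Steps 2 to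 5 is called a cycle. Step 2 (Descent). Compute $d=\min\{\gamma_{ij}: A_i\in T_m,\ B_j\in T_f\}$. Replace $\alpha_i$ by $\alpha_i-d$ for all $A_i\in T_m$ and $\beta_j$ by $\beta_j-d$ for all $B_j\in T_m$. Step 3 (Contact). Select a pair $(i_c,j_c)$ which realized the minimum $d$ in Step 2 (arbitrarily if there are several). Add an edge between $A_{i_c}$ and $B_{j_c}$ with force $0$. The graph is now a single tree. Step 4 (Readjustment). The main path is the unique path from $Q$ to $P$. Number its edges $1,2,3,\dots$ from $Q$ to $P$; it has an odd number of edges. Let $\lambda$ be the minimum of the forces of the odd-numbered edges. Add $\lambda$ to the forces of the even-numbered edges of the main path, and subtract $\lambda$ from the forces of its odd-numbered edges. Step 5 (Breaking). Select an odd-numbered edge of the main path which realized the minimum in Step 4 (arbitrarily if there are several) and delete it. The graph again consists of two trees, the new moving tree (containing $Q$) and the new fixed tree (containing $P$). If the moving tree contains $Q$ alone or the fixed tree contains $P$ alone, the algorithm terminates; otherwise go back to Step 2 for a new cycle. *)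

theory Defs
  imports Complex_Main
begin

section \<open>The transportation problem\<close>

text \<open>Vectors and matrices are functions on \<open>nat\<close> of which only the values at indices
  in \<open>{1..m}\<close> and \<open>{1..n}\<close> matter.\<close>

definition transportation_data ::
    "nat \<Rightarrow> nat \<Rightarrow> (nat \<Rightarrow> real) \<Rightarrow> (nat \<Rightarrow> real) \<Rightarrow> bool" where
  "transportation_data m n a b \<longleftrightarrow>
     1 \<le> m \<and> 1 \<le> n \<and> (\<forall>i\<in>{1..m}. 0 \<le> a i) \<and> (\<forall>j\<in>{1..n}. 0 \<le> b j) \<and>
     (\<Sum>i=1..m. a i) = (\<Sum>j=1..n. b j)"

definition feasible ::
    "nat \<Rightarrow> nat \<Rightarrow> (nat \<Rightarrow> real) \<Rightarrow> (nat \<Rightarrow> real) \<Rightarrow> (nat \<Rightarrow> nat \<Rightarrow> real) \<Rightarrow> bool" where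
  "feasible m n a b f \<longleftrightarrow>
     (\<forall>i\<in>{1..m}. (\<Sum>j=1..n. f i j) = a i) \<and>
     (\<forall>j\<in>{1..n}. (\<Sum>i=1..m. f i j) = b j) \<and>
     (\<forall>i\<in>{1..m}. \<forall>j\<in>{1..n}. 0 \<le> f i j)"

definition objective ::
    "nat \<Rightarrow> nat \<Rightarrow> (nat \<Rightarrow> nat \<Rightarrow> real) \<Rightarrow> (nat \<Rightarrow> nat \<Rightarrow> real) \<Rightarrow> real" where
  "objective m n c f = (\<Sum>i=1..m. \<Sum>j=1..n. c i j * f i j)"

definition optimal_solution ::
    "nat \<Rightarrow> nat \<Rightarrow> (nat \<Rightarrow> real) \<Rightarrow> (nat \<Rightarrow> real) \<Rightarrow> (nat \<Rightarrow> nat \<Rightarrow> real) \<Rightarrow>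
     (nat \<Rightarrow> nat \<Rightarrow> real) \<Rightarrow> bool" where
  "optimal_solution m n a b c f \<longleftrightarrow>
     feasible m n a b f \<and>
     (\<forall>g. feasible m n a b g \<longrightarrow> objective m n c g \<le> objective m n c f)"


section \<open>Graphs carrying forces and potentials\<close>

datatype node = NodeA nat | NodeB nat | NodeP | NodeQ

text \<open>An edge is the two-element set of its ends.  The field \<open>force\<close> is meaningful
  only on members of \<open>edges\<close>.\<close>

record state =
  edges :: "node set set"
  force :: "node set \<Rightarrow> real"
  alpha :: "nat \<Rightarrow> real"
  beta :: "nat \<Rightarrow> real"

definition component :: "node set set \<Rightarrow> node \<Rightarrow> node set" where
  "component E r = {v. (r, v) \<in> {(u, w). {u, w} \<in> E}\<^sup>*}"

abbreviation moving_tree :: "state \<Rightarrow> node set" where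
  "moving_tree s \<equiv> component (edges s) NodeQ"

abbreviation fixed_tree :: "state \<Rightarrow> node set" where
  "fixed_tree s \<equiv> component (edges s) NodeP"

definition path_edges :: "node list \<Rightarrow> node set list" where
  "path_edges p = map (\<lambda>(u, v). {u, v}) (zip p (tl p))"

definition main_path :: "node set set \<Rightarrow> node list \<Rightarrow> bool" where
  "main_path E p \<longleftrightarrow>
     p \<noteq> [] \<and> distinct p \<and> hd p = NodeQ \<and> last p = NodeP \<and> set (path_edges p) \<subseteq> E"

text \<open>The edges of a path are numbered from 1, list positions from 0.\<close>

definition odd_edges :: "node list \<Rightarrow> node set set" where
  "odd_edges p = {path_edges p ! (k - 1) | k. 1 \<le> k \<and> k \<le> length (path_edges p) \<and> odd k}"

definition even_edges :: "node list \<Rightarrow> node set set" where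
  "even_edges p = {path_edges p ! (k - 1) | k. 1 \<le> k \<and> k \<le> length (path_edges p) \<and> even k}"


section \<open>The algorithm\<close>

definition gamma :: "(nat \<Rightarrow> nat \<Rightarrow> real) \<Rightarrow> state \<Rightarrow> nat \<Rightarrow> nat \<Rightarrow> real" where
  "gamma c s i j = alpha s i - beta s j - c i j"

text \<open>The value \<open>csup\<close> is one of the arbitrary choices of the algorithm.\<close>

definition initial_state ::
    "nat \<Rightarrow> nat \<Rightarrow> (nat \<Rightarrow> real) \<Rightarrow> (nat \<Rightarrow> real) \<Rightarrow> (nat \<Rightarrow> nat \<Rightarrow> real) \<Rightarrow> state \<Rightarrow> bool" where
  "initial_state m n a b c s \<longleftrightarrow>
     edges s = {{NodeQ, NodeA i} | i. i \<in> {1..m}} \<union> {{NodeP, NodeB j} | j. j \<in> {1..n}} \<and>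
     (\<forall>i\<in>{1..m}. force s {NodeQ, NodeA i} = a i) \<and>
     (\<forall>j\<in>{1..n}. force s {NodeP, NodeB j} = b j) \<and>
     (\<exists>csup. csup > Max {c i j | i j. i \<in> {1..m} \<and> j \<in> {1..n}} \<and>
        (\<forall>i\<in>{1..m}. alpha s i = csup)) \<and>
     (\<forall>j\<in>{1..n}. beta s j = 0)"

lemma initial_state_exists: "\<exists>s. initial_state m n a b c s"
proof -
  define csup where "csup = Max {c i j | i j. i \<in> {1..m} \<and> j \<in> {1..n}} + 1"
  define fo where "fo = (\<lambda>e. if \<exists>i. e = {NodeQ, NodeA i}
    then a (THE i. e = {NodeQ, NodeA i}) else b (THE j. e = {NodeP, NodeB j}))"
  have "fo {NodeQ, NodeA i} = a i" "fo {NodeP, NodeB i} = b i" for i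
    by (auto simp: fo_def doubleton_eq_iff)
  then have "initial_state m n a b c
     \<lparr>edges = {{NodeQ, NodeA i} | i. i \<in> {1..m}} \<union> {{NodeP, NodeB j} | j. j \<in> {1..n}},
      force = fo, alpha = (\<lambda>_. csup), beta = (\<lambda>_. 0)\<rparr>"
    by (auto simp: initial_state_def csup_def intro!: exI[of _ csup])
  then show ?thesis ..
qed

definition crossing_pairs :: "nat \<Rightarrow> nat \<Rightarrow> state \<Rightarrow> (nat \<times> nat) set" where
  "crossing_pairs m n s =
     {(i, j). i \<in> {1..m} \<and> j \<in> {1..n} \<and> NodeA i \<in> moving_tree s \<and> NodeB j \<in> fixed_tree s}"

definition descent_depth :: "nat \<Rightarrow> nat \<Rightarrow> (nat \<Rightarrow> nat \<Rightarrow> real) \<Rightarrow> state \<Rightarrow> real" where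
  "descent_depth m n c s = Min ((\<lambda>(i, j). gamma c s i j) ` crossing_pairs m n s)"

definition contact_pairs :: "nat \<Rightarrow> nat \<Rightarrow> (nat \<Rightarrow> nat \<Rightarrow> real) \<Rightarrow> state \<Rightarrow> (nat \<times> nat) set" where
  "contact_pairs m n c s =
     {(i, j) \<in> crossing_pairs m n s. gamma c s i j = descent_depth m n c s}"

definition descend :: "nat \<Rightarrow> nat \<Rightarrow> (nat \<Rightarrow> nat \<Rightarrow> real) \<Rightarrow> state \<Rightarrow> state" where
  "descend m n c s = (let d = descent_depth m n c s in
     s\<lparr>alpha := (\<lambda>i. if NodeA i \<in> moving_tree s then alpha s i - d else alpha s i),
       beta := (\<lambda>j. if NodeB j \<in> moving_tree s then beta s j - d else beta s j)\<rparr>)"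

definition add_contact :: "nat \<Rightarrow> nat \<Rightarrow> state \<Rightarrow> state" where
  "add_contact i j s =
     s\<lparr>edges := insert {NodeA i, NodeB j} (edges s),
       force := (force s)({NodeA i, NodeB j} := 0)\<rparr>"

definition readjustment :: "state \<Rightarrow> node list \<Rightarrow> real" where
  "readjustment s p = Min (force s ` odd_edges p)"

definition minimal_edges :: "state \<Rightarrow> node list \<Rightarrow> node set set" where
  "minimal_edges s p = {e \<in> odd_edges p. force s e = readjustment s p}"

definition readjust :: "node list \<Rightarrow> state \<Rightarrow> state" where
  "readjust p s =
     s\<lparr>force := (\<lambda>e. if e \<in> even_edges p then force s e + readjustment s p
                     else if e \<in> odd_edges p then force s e - readjustment s p
                     else force s e)\<rparr>"

definition delete_edge :: "node set \<Rightarrow> state \<Rightarrow> state" where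
  "delete_edge e s = s\<lparr>edges := edges s - {e}\<rparr>"

definition stop_condition :: "state \<Rightarrow> bool" where
  "stop_condition s \<longleftrightarrow> moving_tree s = {NodeQ} \<or> fixed_tree s = {NodeP}"

text \<open>A configuration records the step to be executed next together with the set of
  candidates (pairs or edges realizing a minimum) from which that step has to select.\<close>

datatype config =
    At_Descent state
  | At_Contact state "(nat \<times> nat) set"
  | At_Readjustment state
  | At_Breaking state "node set set"
  | Terminated state

inductive step :: "nat \<Rightarrow> nat \<Rightarrow> (nat \<Rightarrow> nat \<Rightarrow> real) \<Rightarrow> config \<Rightarrow> config \<Rightarrow> bool"
  for m n c where
  descent:
    "step m n c (At_Descent s) (At_Contact (descend m n c s) (contact_pairs m n c s))"
| contact:
    "(i, j) \<in> K \<Longrightarrow> step m n c (At_Contact s K) (At_Readjustment (add_contact i j s))"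
| readjustment:
    "main_path (edges s) p \<Longrightarrow>
     step m n c (At_Readjustment s) (At_Breaking (readjust p s) (minimal_edges s p))"
| breaking_continue:
    "e \<in> M \<Longrightarrow> \<not> stop_condition (delete_edge e s) \<Longrightarrow>
     step m n c (At_Breaking s M) (At_Descent (delete_edge e s))"
| breaking_stop:
    "e \<in> M \<Longrightarrow> stop_condition (delete_edge e s) \<Longrightarrow>
     step m n c (At_Breaking s M) (Terminated (delete_edge e s))"

definition final_flow :: "state \<Rightarrow> nat \<Rightarrow> nat \<Rightarrow> real" where
  "final_flow s i j =
     (if {NodeA i, NodeB j} \<in> edges s then force s {NodeA i, NodeB j} else 0)"

text \<open>Every run from \<open>x\<close>, whatever choices are made, is finite and can only end in a
  configuration \<open>Terminated s\<close>: it neither continues forever nor gets stuck at a step that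
  cannot be executed.\<close>

definition always_terminates :: "nat \<Rightarrow> nat \<Rightarrow> (nat \<Rightarrow> nat \<Rightarrow> real) \<Rightarrow> config \<Rightarrow> bool" where
  "always_terminates m n c x \<longleftrightarrow>
     (\<nexists>r :: nat \<Rightarrow> config. r 0 = x \<and> (\<forall>k. step m n c (r k) (r (Suc k)))) \<and>
     (\<forall>y. (step m n c)\<^sup>*\<^sup>* x y \<longrightarrow> (\<exists>s. y = Terminated s) \<or> (\<exists>z. step m n c y z))"

end

theory Submission
  imports Defs
begin

text \<open>
  Termination has nothing to do with forces or potentials.  Call \<open>Q\<close> and the \<open>B\<close>'s the
  source side and \<open>P\<close> and the \<open>A\<close>'s the other side; every edge joins the two sides, so an
  odd-numbered edge of the main path is one traversed from the source side.  A cycle adds an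
  edge from some \<open>A\<close> in the moving tree to some \<open>B\<close> outside it, and then removes an edge
  \<open>{u, v}\<close> with \<open>u\<close> on the source side, such that afterwards \<open>u\<close> belongs to the moving tree
  and \<open>v\<close> does not.  No infinite sequence of such exchanges exists on a finite set of edges,
  however the pairs and edges are chosen (\<open>no_infinite_exchange\<close>).

  Indeed, suppose there is one, let \<open>Z\<close> be the set of edges removed infinitely often, and
  let \<open>R\<close> be the set of nodes reachable from \<open>Q\<close> by walks that never traverse an edge of \<open>Z\<close>
  starting from its source side.  From some cycle on, all removed edges belong to \<open>Z\<close>; they
  are then useless for such walks and \<open>R\<close> can only grow (\<open>guarded_reach_grows\<close>), so it is
  eventually constant.  Consider the edge from \<open>A\<close> to \<open>B\<close> added by a later cycle.  If \<open>A\<close>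
  were in \<open>R\<close>, then \<open>B\<close> would enter \<open>R\<close>, although it is outside the moving tree before the
  cycle.  So \<open>A\<close> is not in \<open>R\<close>, but it is in the moving tree, and some edge of the graph
  leaves \<open>R\<close>.  That edge lies in \<open>Z\<close> and its end in \<open>R\<close> is on the source side.  Being removed
  infinitely often it is also added again later; at that time its end in \<open>R\<close> would have to
  be a \<open>B\<close> outside the moving tree, whereas \<open>R\<close> is always contained in the moving tree.

  Optimality is complementary slackness.  Throughout a run the graph is a forest, the forces
  are nonnegative, the forces at \<open>A i\<close> and at \<open>B j\<close> add up to \<open>a i\<close> and \<open>b j\<close>, all
  \<open>\<gamma> i j\<close> are nonnegative, and \<open>\<gamma> i j = 0\<close> on each edge between \<open>A i\<close> and \<open>B j\<close>.  When one
  tree has shrunk to a single node, no force is left at \<open>Q\<close> or none is left at \<open>P\<close>;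
  since the totals of \<open>a\<close> and \<open>b\<close> agree, none is left at either (\<open>final_flow_feasible\<close>).
  The potentials then certify that the flow is optimal (\<open>final_flow_optimal\<close>).  The forest
  property and the description of the two trees also ensure that every step can be executed
  (\<open>run_progress\<close>).
\<close>

section \<open>Connectivity in undirected graphs\<close>

lemma component_refl [simp]: "r \<in> component E r"
  by (simp add: component_def)

lemma component_step: "u \<in> component E r \<Longrightarrow> {u, v} \<in> E \<Longrightarrow> v \<in> component E r"
  by (auto simp: component_def intro: rtrancl_into_rtrancl)

lemma component_edge: "{u, v} \<in> E \<Longrightarrow> v \<in> component E u"
  by (rule component_step[OF component_refl])

lemma component_induct [consumes 1, case_names refl step]:
  assumes "v \<in> component E r" and "P r"
    and "\<And>u w. u \<in> component E r \<Longrightarrow> {u, w} \<in> E \<Longrightarrow> P u \<Longrightarrow> P w"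
  shows "P v"
proof -
  have "(r, v) \<in> {(u, w). {u, w} \<in> E}\<^sup>*" using assms(1) by (simp add: component_def)
  then show ?thesis
  proof (induction rule: rtrancl_induct)
    case base then show ?case by (rule assms(2))
  next
    case (step u w) then show ?case using assms(3)[of u w] by (simp add: component_def)
  qed
qed

lemma component_trans: "v \<in> component E u \<Longrightarrow> u \<in> component E r \<Longrightarrow> v \<in> component E r"
  by (auto simp: component_def)

lemma component_sym: "v \<in> component E r \<Longrightarrow> r \<in> component E v"
proof (induction rule: component_induct)
  case (step u w)
  have "u \<in> component E w" using step.hyps(2) by (intro component_edge) (simp add: insert_commute)
  then show ?case using step.IH by (rule component_trans[rotated])
qed simp

lemma component_mono: "E \<subseteq> F \<Longrightarrow> component E r \<subseteq> component F r"
proof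
  fix v assume "E \<subseteq> F" "v \<in> component E r"
  from this(2) show "v \<in> component F r"
    using \<open>E \<subseteq> F\<close> by (induction rule: component_induct) (auto intro: component_step)
qed

lemma component_insert:
  assumes "w \<in> component (insert {x, y} E) u"
  shows "w \<in> component E u \<or> x \<in> component E u \<and> w \<in> component E y
    \<or> y \<in> component E u \<and> w \<in> component E x"
  using assms
proof (induction rule: component_induct)
  case (step v w)
  show ?case
  proof (cases "{v, w} \<in> E")
    case True then show ?thesis using step.IH by (blast intro: component_step)
  next
    case False
    then have "v = x \<and> w = y \<or> v = y \<and> w = x" using step.hyps by (auto simp: doubleton_eq_iff)
    then show ?thesis using step.IH by auto
  qed
qed simp

lemma component_first_edge:
  assumes "component E r \<noteq> {r}"
  obtains y where "{r, y} \<in> E"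
proof -
  have "component E r = {r}" if "\<And>y. {r, y} \<notin> E"
  proof -
    have "v = r" if "v \<in> component E r" for v
      using that by (induction rule: component_induct) (use \<open>\<And>y. {r, y} \<notin> E\<close> in auto)
    then show ?thesis by auto
  qed
  then show ?thesis using assms that by blast
qed

text \<open>A graph is a forest when each of its edges is a bridge.\<close>

definition forest :: "node set set \<Rightarrow> bool" where
  "forest E \<longleftrightarrow> (\<forall>u v. {u, v} \<in> E \<longrightarrow> v \<notin> component (E - {{u, v}}) u)"

lemma forest_subset: "forest E \<Longrightarrow> F \<subseteq> E \<Longrightarrow> forest F"
  unfolding forest_def by (meson Diff_mono component_mono subset_iff subset_refl)

text \<open>A second connection between the ends of an old edge, using the new edge, would already
  have joined the two ends of the new edge in the old graph.\<close>

lemma forest_insert: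
  assumes "forest E" and "y \<notin> component E x"
  shows "forest (insert {x, y} E)"
  unfolding forest_def
proof (intro allI impI notI)
  fix u v assume uv: "{u, v} \<in> insert {x, y} E"
    and v: "v \<in> component (insert {x, y} E - {{u, v}}) u"
  let ?F = "E - {{u, v}}"
  have mono: "component ?F r \<subseteq> component E r" for r by (rule component_mono) auto
  show False
  proof (cases "{u, v} = {x, y}")
    case True
    then have "v \<in> component ?F u" using v by simp
    then have "v \<in> component E u" using mono by blast
    with True show False using assms(2) component_sym by (auto simp: doubleton_eq_iff)
  next
    case False
    then have E: "{u, v} \<in> E" using uv by auto
    have "insert {x, y} E - {{u, v}} = insert {x, y} ?F" using False by auto
    then have "v \<in> component (insert {x, y} ?F) u" using v by simp
    moreover have "v \<notin> component ?F u" using assms(1) E by (auto simp: forest_def)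
    ultimately have "x \<in> component ?F u \<and> v \<in> component ?F y \<or> y \<in> component ?F u \<and> v \<in> component ?F x"
      using component_insert by blast
    then have "x \<in> component E u \<and> v \<in> component E y \<or> y \<in> component E u \<and> v \<in> component E x"
      using mono by blast
    moreover have "v \<in> component E u" using E by (rule component_edge)
    ultimately show False using assms(2) by (meson component_sym component_trans)
  qed
qed

section \<open>Paths with numbered edges\<close>

lemma path_edges_simps [simp]:
  "path_edges [] = []" "path_edges [x] = []"
  "path_edges (x # y # p) = {x, y} # path_edges (y # p)"
  by (simp_all add: path_edges_def)

lemma path_edges_subset: "e \<in> set (path_edges p) \<Longrightarrow> e \<subseteq> set p"
  by (induction p rule: induct_list012) auto

lemma path_edges_append:
  "path_edges (xs @ u # v # ys) = path_edges (xs @ [u]) @ {u, v} # path_edges (v # ys)"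
  by (induction xs rule: induct_list012) auto

lemma path_edges_suffix: "set (path_edges ys) \<subseteq> set (path_edges (xs @ ys))"
proof (induction xs)
  case (Cons x xs)
  then show ?case by (cases "xs @ ys") auto
qed simp

lemma path_component: "p \<noteq> [] \<Longrightarrow> set (path_edges p) \<subseteq> E \<Longrightarrow> last p \<in> component E (hd p)"
  by (induction p rule: induct_list012) (auto intro: component_trans component_edge)

lemma main_path_exists:
  assumes "NodeP \<in> component E NodeQ"
  shows "\<exists>p. main_path E p"
proof -
  have "\<exists>p. p \<noteq> [] \<and> distinct p \<and> hd p = v \<and> last p = NodeP \<and> set (path_edges p) \<subseteq> E"
    if "v \<in> component E NodeP" for v
    using that
  proof (induction rule: component_induct)
    case refl
    show ?case by (rule exI[of _ "[NodeP]"]) simp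
  next
    case (step u w)
    then obtain p where p: "p \<noteq> []" "distinct p" "hd p = u" "last p = NodeP" "set (path_edges p) \<subseteq> E"
      by blast
    show ?case
    proof (cases "w \<in> set p")
      case True
      then obtain xs ys where "p = xs @ w # ys" by (auto simp: in_set_conv_decomp)
      then show ?thesis using p path_edges_suffix[of "w # ys" xs]
        by (intro exI[of _ "w # ys"]) auto
    next
      case False
      obtain q where "p = u # q" using p by (cases p) auto
      then show ?thesis using p False step.hyps
        by (intro exI[of _ "w # p"]) (auto simp: insert_commute)
    qed
  qed
  then show ?thesis unfolding main_path_def using component_sym[OF assms] by blast
qed

text \<open>The conversion from edge numbers to list positions exchanges odd and even.\<close>

lemma odd_edges_position:
  "e \<in> odd_edges p \<longleftrightarrow> (\<exists>l < length (path_edges p). even l \<and> path_edges p ! l = e)"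
proof
  assume "e \<in> odd_edges p"
  then obtain k where "e = path_edges p ! (k - 1)" "1 \<le> k" "k \<le> length (path_edges p)" "odd k"
    unfolding odd_edges_def by blast
  then show "\<exists>l < length (path_edges p). even l \<and> path_edges p ! l = e"
    by (intro exI[of _ "k - 1"]) simp
next
  assume "\<exists>l < length (path_edges p). even l \<and> path_edges p ! l = e"
  then obtain l where "l < length (path_edges p)" "even l" "path_edges p ! l = e" by blast
  then have "e = path_edges p ! (Suc l - 1) \<and> 1 \<le> Suc l \<and> Suc l \<le> length (path_edges p) \<and> odd (Suc l)"
    by simp
  then show "e \<in> odd_edges p" unfolding odd_edges_def by blast
qed

lemma even_edges_position:
  "e \<in> even_edges p \<longleftrightarrow> (\<exists>l < length (path_edges p). odd l \<and> path_edges p ! l = e)"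
proof
  assume "e \<in> even_edges p"
  then obtain k where "e = path_edges p ! (k - 1)" "1 \<le> k" "k \<le> length (path_edges p)" "even k"
    unfolding even_edges_def by blast
  then show "\<exists>l < length (path_edges p). odd l \<and> path_edges p ! l = e"
    by (intro exI[of _ "k - 1"]) simp
next
  assume "\<exists>l < length (path_edges p). odd l \<and> path_edges p ! l = e"
  then obtain l where "l < length (path_edges p)" "odd l" "path_edges p ! l = e" by blast
  then have "e = path_edges p ! (Suc l - 1) \<and> 1 \<le> Suc l \<and> Suc l \<le> length (path_edges p) \<and> even (Suc l)"
    by simp
  then show "e \<in> even_edges p" unfolding even_edges_def by blast
qed

lemma odd_even_edges_short [simp]:
  "odd_edges [] = {}" "even_edges [] = {}" "odd_edges [x] = {}" "even_edges [x] = {}"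
  by (simp_all add: odd_edges_position even_edges_position set_eq_iff)

lemma odd_edges_Cons [simp]: "odd_edges (x # y # p) = insert {x, y} (even_edges (y # p))"
proof (rule set_eqI)
  fix e
  have "e \<in> odd_edges (x # y # p) \<longleftrightarrow>
    (\<exists>l < Suc (length (path_edges (y # p))). even l \<and> ({x, y} # path_edges (y # p)) ! l = e)"
    by (simp add: odd_edges_position)
  also have "\<dots> \<longleftrightarrow> {x, y} = e \<or> (\<exists>l < length (path_edges (y # p)). odd l \<and> path_edges (y # p) ! l = e)"
    unfolding Ex_less_Suc2 by simp
  finally show "e \<in> odd_edges (x # y # p) \<longleftrightarrow> e \<in> insert {x, y} (even_edges (y # p))"
    by (auto simp: even_edges_position)
qed

lemma even_edges_Cons [simp]: "even_edges (x # y # p) = odd_edges (y # p)"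
proof (rule set_eqI)
  fix e
  have "e \<in> even_edges (x # y # p) \<longleftrightarrow>
    (\<exists>l < Suc (length (path_edges (y # p))). odd l \<and> ({x, y} # path_edges (y # p)) ! l = e)"
    by (simp add: even_edges_position)
  also have "\<dots> \<longleftrightarrow> (\<exists>l < length (path_edges (y # p)). even l \<and> path_edges (y # p) ! l = e)"
    unfolding Ex_less_Suc2 by simp
  finally show "e \<in> even_edges (x # y # p) \<longleftrightarrow> e \<in> odd_edges (y # p)"
    by (simp add: odd_edges_position)
qed

lemma odd_even_union: "odd_edges p \<union> even_edges p = set (path_edges p)"
  by (induction p rule: induct_list012) auto

lemma odd_even_disjoint: "distinct p \<Longrightarrow> odd_edges p \<inter> even_edges p = {}"
proof (induction p rule: induct_list012)
  case (3 x y p)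
  have "{x, y} \<notin> set (path_edges (y # p))" using 3(3) path_edges_subset[of "{x, y}" "y # p"] by auto
  then show ?case using 3 odd_even_union[of "y # p"] by auto
qed simp_all

lemma finite_odd_edges: "finite (odd_edges p)"
  using odd_even_union[of p] by (metis List.finite_set finite_Un)

lemma odd_edges_nonempty: "main_path E p \<Longrightarrow> odd_edges p \<noteq> {}"
  unfolding main_path_def by (cases p; cases "tl p") auto

text \<open>Why readjustment keeps the sum of the forces at each \<open>A i\<close> and \<open>B j\<close>: an inner node of
  the path meets one odd-numbered and one even-numbered edge, whose changes cancel.  The last
  node is excluded because the sign there depends on the parity of the length.\<close>

lemma alternating_sum_telescopes:
  fixes t :: real
  assumes "finite E" and "set (path_edges p) \<subseteq> E" and "distinct p"
    and "x \<noteq> last p"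
  shows "(\<Sum>e\<in>{e \<in> E. x \<in> e}. if e \<in> odd_edges p then t else if e \<in> even_edges p then - t else 0)
    = (if p \<noteq> [] \<and> x = hd p then t else 0)"
  using assms(2-4)
proof (induction p arbitrary: t rule: induct_list012)
  case (3 y z p)
  let ?I = "{e \<in> E. x \<in> e}"
  let ?w = "\<lambda>q t e. if e \<in> odd_edges q then t else if e \<in> even_edges q then - t else (0::real)"
  have new: "{y, z} \<notin> set (path_edges (z # p))"
    using 3(4) path_edges_subset[of "{y, z}" "z # p"] by auto
  then have "{y, z} \<notin> odd_edges (z # p)" "{y, z} \<notin> even_edges (z # p)"
    using odd_even_union[of "z # p"] by auto
  then have "?w (y # z # p) t e = (if e = {y, z} then t else 0) + ?w (z # p) (- t) e" for e
    using odd_even_disjoint[of "z # p"] 3(4) by auto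
  then have "(\<Sum>e\<in>?I. ?w (y # z # p) t e)
    = (\<Sum>e\<in>?I. if e = {y, z} then t else 0) + (\<Sum>e\<in>?I. ?w (z # p) (- t) e)"
    by (simp only: sum.distrib)
  also have "(\<Sum>e\<in>?I. if e = {y, z} then t else 0) = (if x \<in> {y, z} then t else 0)"
    using assms(1) 3(3) by (subst sum.delta) auto
  also have "(\<Sum>e\<in>?I. ?w (z # p) (- t) e) = (if x = z then - t else 0)"
    using 3(2)[of "- t"] 3(3-5) by simp
  finally show ?case using 3(4) by auto
qed simp_all

text \<open>Every edge joins a node of the class of \<open>Q\<close> and the \<open>B\<close>'s to a node of the class
  of \<open>P\<close> and the \<open>A\<close>'s; so the odd-numbered edges of the main path are those traversed
  from the first class to the second.\<close>

fun source_side :: "node \<Rightarrow> bool" where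
  "source_side NodeQ = True"
| "source_side (NodeB j) = True"
| "source_side NodeP = False"
| "source_side (NodeA i) = False"

text \<open>The even-numbered edges are included because peeling off the first node exchanges the
  two kinds, so that neither half can be proved by induction alone.\<close>

lemma path_edge_direction:
  assumes "\<And>x y. {x, y} \<in> set (path_edges p) \<Longrightarrow> source_side x \<noteq> source_side y"
  shows "(e \<in> odd_edges p \<longrightarrow> (\<exists>xs u v ys. p = xs @ u # v # ys \<and> e = {u, v} \<and>
           source_side u = source_side (hd p) \<and> source_side v \<noteq> source_side (hd p))) \<and>
         (e \<in> even_edges p \<longrightarrow> (\<exists>xs u v ys. p = xs @ u # v # ys \<and> e = {u, v} \<and>
           source_side u \<noteq> source_side (hd p) \<and> source_side v = source_side (hd p)))"
  using assms
proof (induction p rule: induct_list012)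
  case 1 show ?case by simp
next
  case (2 x) show ?case by simp
next
  case (3 x y p)
  have xy: "source_side x \<noteq> source_side y" using 3(3)[of x y] by simp
  have bip: "source_side v \<noteq> source_side w" if "{v, w} \<in> set (path_edges (y # p))" for v w
    using 3(3)[of v w] that by simp
  note IH = 3(2)[OF bip]
  have lift: "\<exists>xs' u' v' ys'. x # y # p = xs' @ u' # v' # ys' \<and> {u, v} = {u', v'} \<and> Q u' v'"
    if "y # p = xs @ u # v # ys" "Q u v" for xs u v ys and Q :: "node \<Rightarrow> node \<Rightarrow> bool"
    by (rule exI[of _ "x # xs"]) (use that in auto)
  show ?case
  proof (intro conjI impI)
    assume "e \<in> odd_edges (x # y # p)"
    then consider "e = {x, y}" | "e \<in> even_edges (y # p)" by auto
    then show "\<exists>xs u v ys. x # y # p = xs @ u # v # ys \<and> e = {u, v} \<and>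
      source_side u = source_side (hd (x # y # p)) \<and> source_side v \<noteq> source_side (hd (x # y # p))"
    proof cases
      case 1 then show ?thesis using xy by (intro exI[of _ "[]"]) auto
    next
      case 2
      then obtain xs u v ys where "y # p = xs @ u # v # ys" "e = {u, v}"
        "source_side u \<noteq> source_side y" "source_side v = source_side y"
        using IH by auto
      then show ?thesis
        using lift[of xs u v ys "\<lambda>u v. source_side u = source_side x \<and> source_side v \<noteq> source_side x"] xy
        by auto
    qed
  next
    assume "e \<in> even_edges (x # y # p)"
    then obtain xs u v ys where "y # p = xs @ u # v # ys" "e = {u, v}"
      "source_side u = source_side y" "source_side v \<noteq> source_side y"
      using IH by auto
    then show "\<exists>xs u v ys. x # y # p = xs @ u # v # ys \<and> e = {u, v} \<and>
      source_side u \<noteq> source_side (hd (x # y # p)) \<and> source_side v = source_side (hd (x # y # p))"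
      using lift[of xs u v ys "\<lambda>u v. source_side u \<noteq> source_side x \<and> source_side v = source_side x"] xy
      by auto
  qed
qed

text \<open>The facts about a removed edge on which everything after the breaking depends.\<close>

definition breakable :: "node set set \<Rightarrow> node set \<Rightarrow> bool" where
  "breakable E e \<longleftrightarrow> e \<in> E \<and> (\<exists>u v. e = {u, v} \<and> source_side u \<and> \<not> source_side v \<and>
     u \<in> component (E - {e}) NodeQ \<and> v \<notin> component (E - {e}) NodeQ \<and>
     v \<in> component (E - {e}) NodeP)"

lemma odd_edge_breakable:
  assumes "forest E" and "main_path E p" and "e \<in> odd_edges p"
    and bip: "\<And>x y. {x, y} \<in> E \<Longrightarrow> source_side x \<noteq> source_side y"
  shows "breakable E e"
proof -
  have p: "p \<noteq> []" "distinct p" "hd p = NodeQ" "last p = NodeP" "set (path_edges p) \<subseteq> E"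
    using assms(2) by (auto simp: main_path_def)
  obtain xs u v ys where split: "p = xs @ u # v # ys" and e: "e = {u, v}"
    and side: "source_side u" "\<not> source_side v"
  proof -
    have "source_side x \<noteq> source_side y" if "{x, y} \<in> set (path_edges p)" for x y
      using bip that p(5) by blast
    then have "\<exists>xs u v ys. p = xs @ u # v # ys \<and> e = {u, v} \<and>
      source_side u = source_side (hd p) \<and> source_side v \<noteq> source_side (hd p)"
      using path_edge_direction[of p e] assms(3) by blast
    then show ?thesis using that unfolding p(3) source_side.simps by blast
  qed
  let ?F = "E - {e}"
  have edges: "set (path_edges (xs @ [u])) \<subseteq> E" "e \<in> E" "set (path_edges (v # ys)) \<subseteq> E"
    using p(5) e unfolding split path_edges_append by auto
  have "e \<notin> set (path_edges (xs @ [u]))" "e \<notin> set (path_edges (v # ys))"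
    using path_edges_subset[of e "xs @ [u]"] path_edges_subset[of e "v # ys"] p(2) split e by auto
  then have "last (xs @ [u]) \<in> component ?F (hd (xs @ [u]))" "last (v # ys) \<in> component ?F (hd (v # ys))"
    using edges by (intro path_component; auto)+
  moreover have "hd (xs @ [u]) = NodeQ" "last (v # ys) = NodeP"
    using p split by (auto simp: hd_append split: if_splits)
  ultimately have u: "u \<in> component ?F NodeQ" and v: "v \<in> component ?F NodeP"
    by (auto intro: component_sym)
  have "v \<notin> component ?F u" using assms(1) edges(2) e by (auto simp: forest_def)
  then have "v \<notin> component ?F NodeQ" using u by (meson component_sym component_trans)
  then show ?thesis unfolding breakable_def using e side u v edges(2) by blast
qed

section \<open>Impossibility of infinitely many cycles\<close>

text \<open>A cycle of the algorithm with forces and potentials forgotten.\<close>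

definition exchange_by ::
    "nat \<Rightarrow> nat \<Rightarrow> node \<Rightarrow> node \<Rightarrow> node set set \<Rightarrow> node set set \<Rightarrow> bool" where
  "exchange_by i j u v E E' \<longleftrightarrow>
     NodeA i \<in> component E NodeQ \<and> NodeB j \<notin> component E NodeQ \<and>
     {u, v} \<in> insert {NodeA i, NodeB j} E \<and> E' = insert {NodeA i, NodeB j} E - {{u, v}} \<and>
     source_side u \<and> \<not> source_side v \<and>
     u \<in> component E' NodeQ \<and> v \<notin> component E' NodeQ"

definition exchange :: "node set set \<Rightarrow> node set set \<Rightarrow> bool" where
  "exchange E E' \<longleftrightarrow> (\<exists>i j u v. exchange_by i j u v E E')"

text \<open>Edges of \<open>Z\<close> are one-way: they may be traversed towards the source side only.  A newly
  added edge can always be traversed from its \<open>A\<close> to its \<open>B\<close>, while a walk from \<open>Q\<close> cannot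
  use an edge of \<open>Z\<close> in the direction in which it is about to be cut.\<close>

definition guarded_steps :: "node set set \<Rightarrow> node set set \<Rightarrow> (node \<times> node) set" where
  "guarded_steps Z E = {(x, y). {x, y} \<in> E \<and> ({x, y} \<in> Z \<longrightarrow> \<not> source_side x)}"

definition guarded_reach :: "node set set \<Rightarrow> node set set \<Rightarrow> node set" where
  "guarded_reach Z E = {x. (NodeQ, x) \<in> (guarded_steps Z E)\<^sup>*}"

lemma guarded_reach_Q: "NodeQ \<in> guarded_reach Z E"
  by (simp add: guarded_reach_def)

lemma guarded_reach_step:
  assumes "x \<in> guarded_reach Z E" and "{x, y} \<in> E" and "{x, y} \<notin> Z \<or> \<not> source_side x"
  shows "y \<in> guarded_reach Z E"
proof -
  have "(x, y) \<in> guarded_steps Z E" using assms(2,3) by (auto simp: guarded_steps_def)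
  then show ?thesis using assms(1) by (simp add: guarded_reach_def)
qed

lemma guarded_reach_induct [consumes 1, case_names base step]:
  assumes "v \<in> guarded_reach Z E" and "P NodeQ"
    and "\<And>x y. x \<in> guarded_reach Z E \<Longrightarrow> {x, y} \<in> E \<Longrightarrow> {x, y} \<notin> Z \<or> \<not> source_side x \<Longrightarrow> P x \<Longrightarrow> P y"
  shows "P v"
proof -
  have "(NodeQ, v) \<in> (guarded_steps Z E)\<^sup>*" using assms(1) by (simp add: guarded_reach_def)
  then show ?thesis
  proof (induction rule: rtrancl_induct)
    case base then show ?case by (rule assms(2))
  next
    case (step x y)
    then have "x \<in> guarded_reach Z E" "{x, y} \<in> E" "{x, y} \<notin> Z \<or> \<not> source_side x"
      unfolding guarded_reach_def guarded_steps_def by blast+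
    then show ?case using step.IH by (rule assms(3))
  qed
qed

lemma guarded_reach_subset_component: "guarded_reach Z E \<subseteq> component E NodeQ"
proof
  fix v assume "v \<in> guarded_reach Z E"
  then show "v \<in> component E NodeQ"
    by (induction rule: guarded_reach_induct) (auto intro: component_step)
qed

text \<open>A walk could be destroyed only by using the removed edge \<open>{u, v}\<close>.  From \<open>u\<close> to \<open>v\<close> this
  is forbidden, and the walk never is at \<open>v\<close>, since what it has reached so far is still
  connected to \<open>Q\<close> after the removal.\<close>

lemma guarded_reach_grows:
  assumes "E - {{u, v}} \<subseteq> E'" and "{u, v} \<in> Z" and "source_side u" and "v \<notin> component E' NodeQ"
  shows "guarded_reach Z E \<subseteq> guarded_reach Z E'"
proof
  fix w assume "w \<in> guarded_reach Z E"
  then show "w \<in> guarded_reach Z E'"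
  proof (induction rule: guarded_reach_induct)
    case base show ?case by (rule guarded_reach_Q)
  next
    case (step x y)
    have "x \<in> component E' NodeQ" using step(4) guarded_reach_subset_component ..
    then have "x \<noteq> v" using assms(4) by metis
    then have "{x, y} \<noteq> {u, v}" using step(3) assms(2,3) by (metis doubleton_eq_iff)
    then have "{x, y} \<in> E'" using step(2) assms(1) by blast
    then show ?case by (rule guarded_reach_step[OF step(4) _ step(3)])
  qed
qed

lemma eventually_constant_of_increasing:
  fixes R :: "nat \<Rightarrow> 'a set"
  assumes "finite X" and "\<And>k. R k \<subseteq> X" and "\<And>k. N \<le> k \<Longrightarrow> R k \<subseteq> R (Suc k)"
  shows "\<exists>M\<ge>N. \<forall>k\<ge>M. R k = R M"
proof -
  have mono: "R k \<subseteq> R l" if "N \<le> k" "k \<le> l" for k l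
    using that(2)
  proof (induction rule: dec_induct)
    case (step l)
    then show ?case using assms(3)[of l] that(1) by auto
  qed simp
  have "\<forall>\<^sub>F k in sequentially. x \<in> R k \<longleftrightarrow> (\<exists>l\<ge>N. x \<in> R l)" for x
  proof (cases "\<exists>l\<ge>N. x \<in> R l")
    case True
    then obtain l where "l \<ge> N" "x \<in> R l" by blast
    then have "\<forall>k\<ge>l. x \<in> R k \<longleftrightarrow> (\<exists>l\<ge>N. x \<in> R l)" using mono True by blast
    then show ?thesis unfolding eventually_sequentially by blast
  next
    case False
    then have "\<forall>k\<ge>N. x \<in> R k \<longleftrightarrow> (\<exists>l\<ge>N. x \<in> R l)" by blast
    then show ?thesis unfolding eventually_sequentially by blast
  qed
  then have "\<forall>\<^sub>F k in sequentially. \<forall>x\<in>X. x \<in> R k \<longleftrightarrow> (\<exists>l\<ge>N. x \<in> R l)"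
    using assms(1) by (simp add: eventually_ball_finite)
  then obtain M where M: "\<forall>k\<ge>M. \<forall>x\<in>X. x \<in> R k \<longleftrightarrow> (\<exists>l\<ge>N. x \<in> R l)"
    unfolding eventually_sequentially by blast
  have "R k = R (max M N)" if "k \<ge> max M N" for k
  proof -
    have "x \<in> R k \<longleftrightarrow> x \<in> R (max M N)" if "x \<in> X" for x
      using M[rule_format, OF _ that, of k] M[rule_format, OF _ that, of "max M N"] \<open>k \<ge> max M N\<close>
      by simp
    then show ?thesis using assms(2) by blast
  qed
  then show ?thesis using max.cobounded2 by blast
qed

theorem no_infinite_exchange:
  fixes E :: "nat \<Rightarrow> node set set"
  assumes "finite (\<Union>F)" and "\<And>k. E k \<subseteq> F"
  shows "\<not> (\<forall>k. exchange (E k) (E (Suc k)))"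
proof
  assume "\<forall>k. exchange (E k) (E (Suc k))"
  then obtain i j u v where ex: "\<And>k. exchange_by (i k) (j k) (u k) (v k) (E k) (E (Suc k))"
    unfolding exchange_def by metis
  have A: "NodeA (i k) \<in> component (E k) NodeQ" and B: "NodeB (j k) \<notin> component (E k) NodeQ"
    and added_or_old: "{u k, v k} \<in> insert {NodeA (i k), NodeB (j k)} (E k)"
    and next_E: "E (Suc k) = insert {NodeA (i k), NodeB (j k)} (E k) - {{u k, v k}}"
    and side: "source_side (u k)" "\<not> source_side (v k)"
    and u: "u k \<in> component (E (Suc k)) NodeQ" and v: "v k \<notin> component (E (Suc k)) NodeQ" for k
    using ex[of k] unfolding exchange_by_def by blast+
  define new where "new k = {NodeA (i k), NodeB (j k)}" for k
  define old where "old k = {u k, v k}" for k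
  \<comment> \<open>Otherwise the removed edge has \<open>u k\<close> as its \<open>B\<close>, which was not connected to \<open>Q\<close>.\<close>
  have old_new: "old k \<noteq> new k" for k
  proof
    assume eq: "old k = new k"
    then have "u k = NodeB (j k)"
      using side[of k] unfolding old_def new_def doubleton_eq_iff by auto
    moreover have "E (Suc k) \<subseteq> E k" using eq unfolding old_def new_def next_E by blast
    ultimately show False using u[of k] B[of k] component_mono[of "E (Suc k)" "E k" NodeQ] by auto
  qed
  have old: "old k \<in> E k" for k using added_or_old[of k] old_new[of k] unfolding old_def new_def by blast
  have finF: "finite F" using assms(1) by (rule finite_UnionD)
  define Z where "Z = {e. \<forall>k. \<exists>l>k. old l = e}"
  have "\<forall>\<^sub>F k in sequentially. old k \<noteq> e" if "e \<in> F - Z" for e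
    using that unfolding Z_def eventually_at_top_dense by blast
  then have "\<forall>\<^sub>F k in sequentially. \<forall>e\<in>F - Z. old k \<noteq> e"
    using finF by (intro eventually_ball_finite) auto
  then obtain N where "\<forall>k\<ge>N. \<forall>e\<in>F - Z. old k \<noteq> e" unfolding eventually_sequentially by blast
  then have N: "old k \<in> Z" if "k \<ge> N" for k using that old[of k] assms(2)[of k] by blast
  \<comment> \<open>Between two removals an edge must have been added again.\<close>
  have recur: "\<exists>l\<ge>k. new l = e" if eZ: "e \<in> Z" for e k
  proof (rule ccontr)
    assume neg: "\<not> (\<exists>l\<ge>k. new l = e)"
    obtain k1 where k1: "k1 > k" "old k1 = e" using eZ unfolding Z_def by blast
    have gone: "e \<notin> E l" if "l \<ge> Suc k1" for l
      using that
    proof (induction rule: dec_induct)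
      case base
      show ?case using k1(2) unfolding next_E old_def by blast
    next
      case (step l)
      have "k \<le> l" using step.hyps(1) k1(1) by linarith
      then have "new l \<noteq> e" using neg by blast
      then show ?case using step.IH unfolding next_E new_def by blast
    qed
    obtain k2 where "k2 > k1" "old k2 = e" using eZ unfolding Z_def by blast
    then show False using gone[of k2] old[of k2] by simp
  qed
  define R where "R k = guarded_reach Z (E k)" for k
  have grow: "R k \<subseteq> R (Suc k)" if "k \<ge> N" for k
    unfolding R_def
    by (rule guarded_reach_grows[of _ "u k" "v k"]) (use N[OF that] side v next_E in \<open>auto simp: old_def\<close>)
  have "R k \<subseteq> insert NodeQ (\<Union>F)" for k
  proof
    fix x assume "x \<in> R k"
    then show "x \<in> insert NodeQ (\<Union>F)" unfolding R_def
    proof (induction rule: guarded_reach_induct)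
      case (step x y)
      then have "{x, y} \<in> F" using assms(2) by blast
      then show ?case by blast
    qed simp
  qed
  then obtain M where M: "M \<ge> N" "\<And>k. k \<ge> M \<Longrightarrow> R k = R M"
    using eventually_constant_of_increasing[of "insert NodeQ (\<Union>F)" R N] assms(1) grow by auto
  have notA: "NodeA (i M) \<notin> R M"
  proof
    assume "NodeA (i M) \<in> R M"
    then have "NodeA (i M) \<in> R (Suc M)" using grow M(1) by blast
    moreover have "{NodeA (i M), NodeB (j M)} \<in> E (Suc M)"
      using next_E[of M] old_new[of M] by (auto simp: old_def new_def)
    ultimately have "NodeB (j M) \<in> R (Suc M)"
      unfolding R_def by (rule guarded_reach_step) simp
    then have "NodeB (j M) \<in> R M" using M(2)[of "Suc M"] by simp
    then show False using B[of M] guarded_reach_subset_component unfolding R_def by blast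
  qed
  have "\<exists>x y. x \<in> R M \<and> y \<notin> R M \<and> {x, y} \<in> E M"
  proof (rule ccontr)
    assume no: "\<nexists>x y. x \<in> R M \<and> y \<notin> R M \<and> {x, y} \<in> E M"
    have "NodeA (i M) \<in> R M" using A[of M]
      by (induction rule: component_induct) (use no guarded_reach_Q R_def in auto)
    then show False using notA by simp
  qed
  then obtain x y where xy: "x \<in> R M" "y \<notin> R M" "{x, y} \<in> E M" by blast
  then have Z: "{x, y} \<in> Z" "source_side x" using guarded_reach_step[of x Z "E M" y] unfolding R_def by metis+
  then obtain l where l: "l \<ge> M" "new l = {x, y}" using recur by blast
  then have "x = NodeB (j l)" using Z(2) by (auto simp: new_def doubleton_eq_iff)
  moreover have "x \<in> R l" using xy(1) M(2)[OF l(1)] by simp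
  ultimately show False using B[of l] guarded_reach_subset_component unfolding R_def by blast
qed

section \<open>Invariants of the algorithm\<close>

definition nodes :: "nat \<Rightarrow> nat \<Rightarrow> node set" where
  "nodes m n = {NodeQ, NodeP} \<union> NodeA ` {1..m} \<union> NodeB ` {1..n}"

definition admissible_edges :: "nat \<Rightarrow> nat \<Rightarrow> node set set" where
  "admissible_edges m n = {{NodeQ, NodeA i} | i. i \<in> {1..m}} \<union> {{NodeP, NodeB j} | j. j \<in> {1..n}} \<union>
     {{NodeA i, NodeB j} | i j. i \<in> {1..m} \<and> j \<in> {1..n}}"

definition load :: "state \<Rightarrow> node \<Rightarrow> real" where
  "load s x = (\<Sum>e\<in>{e \<in> edges s. x \<in> e}. force s e)"

text \<open>The properties kept by every single step; in contrast to them, the shape of the graph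
  alternates between two trees and one.\<close>

definition sound ::
    "nat \<Rightarrow> nat \<Rightarrow> (nat \<Rightarrow> real) \<Rightarrow> (nat \<Rightarrow> real) \<Rightarrow> (nat \<Rightarrow> nat \<Rightarrow> real) \<Rightarrow> state \<Rightarrow> bool" where
  "sound m n a b c s \<longleftrightarrow>
     edges s \<subseteq> admissible_edges m n \<and> forest (edges s) \<and>
     (\<forall>e\<in>edges s. 0 \<le> force s e) \<and>
     (\<forall>i\<in>{1..m}. load s (NodeA i) = a i) \<and> (\<forall>j\<in>{1..n}. load s (NodeB j) = b j) \<and>
     (\<forall>i\<in>{1..m}. \<forall>j\<in>{1..n}. 0 \<le> gamma c s i j) \<and>
     (\<forall>i\<in>{1..m}. \<forall>j\<in>{1..n}. {NodeA i, NodeB j} \<in> edges s \<longrightarrow> gamma c s i j = 0)"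

definition two_trees :: "nat \<Rightarrow> nat \<Rightarrow> state \<Rightarrow> bool" where
  "two_trees m n s \<longleftrightarrow> NodeP \<notin> moving_tree s \<and> nodes m n \<subseteq> moving_tree s \<union> fixed_tree s"

lemma two_trees_disjoint: "two_trees m n s \<Longrightarrow> x \<in> fixed_tree s \<Longrightarrow> x \<notin> moving_tree s"
  unfolding two_trees_def by (meson component_sym component_trans)

lemma finite_admissible: "finite (\<Union>(admissible_edges m n))"
  by (rule finite_subset[of _ "nodes m n"]) (auto simp: admissible_edges_def nodes_def)

lemma finite_edges: "sound m n a b c s \<Longrightarrow> finite (edges s)"
  unfolding sound_def using finite_admissible finite_UnionD finite_subset by blast

lemma admissible_bipartite: "{x, y} \<in> admissible_edges m n \<Longrightarrow> source_side x \<noteq> source_side y"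
  by (auto simp: admissible_edges_def doubleton_eq_iff)

lemma crossing_pairs_finite: "finite (crossing_pairs m n s)"
  by (rule finite_subset[of _ "{1..m} \<times> {1..n}"]) (auto simp: crossing_pairs_def)

lemma crossing_pairs_nonempty:
  assumes "edges s \<subseteq> admissible_edges m n" and "\<not> stop_condition s"
  shows "crossing_pairs m n s \<noteq> {}"
proof -
  obtain x y where "{NodeQ, x} \<in> edges s" "{NodeP, y} \<in> edges s"
    using assms(2) by (metis stop_condition_def component_first_edge)
  then have "x \<in> NodeA ` {1..m}" "x \<in> moving_tree s" "y \<in> NodeB ` {1..n}" "y \<in> fixed_tree s"
    using assms(1) by (auto simp: admissible_edges_def doubleton_eq_iff dest: component_edge)
  then obtain i j where "(i, j) \<in> crossing_pairs m n s" unfolding crossing_pairs_def by blast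
  then show ?thesis by blast
qed

lemma descend_simps [simp]:
  "edges (descend m n c s) = edges s" "force (descend m n c s) = force s"
  "crossing_pairs m n' (descend m n c s) = crossing_pairs m n' s"
  "load (descend m n c s) = load s"
  by (simp_all add: descend_def Let_def crossing_pairs_def load_def fun_eq_iff)

lemma gamma_descend:
  "gamma c (descend m n c s) i j = gamma c s i j
     - (if NodeA i \<in> moving_tree s then descent_depth m n c s else 0)
     + (if NodeB j \<in> moving_tree s then descent_depth m n c s else 0)"
  by (simp add: gamma_def descend_def Let_def)

text \<open>A descent decreases \<open>\<gamma>\<close> exactly on the crossing pairs, by the minimum over them.  As the
  two trees contain all nodes, no other \<open>\<gamma>\<close> decreases; on edges it stays \<open>0\<close> because both ends
  move together.\<close>

lemma descend_sound:
  assumes "sound m n a b c s" and "two_trees m n s" and "\<not> stop_condition s"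
  shows "sound m n a b c (descend m n c s)"
proof -
  let ?d = "descent_depth m n c s"
  have adm: "edges s \<subseteq> admissible_edges m n"
    and pos: "\<And>i j. i \<in> {1..m} \<Longrightarrow> j \<in> {1..n} \<Longrightarrow> 0 \<le> gamma c s i j"
    and tight: "\<And>i j. i \<in> {1..m} \<Longrightarrow> j \<in> {1..n} \<Longrightarrow> {NodeA i, NodeB j} \<in> edges s \<Longrightarrow> gamma c s i j = 0"
    using assms(1) by (auto simp: sound_def)
  have "?d \<in> (\<lambda>(i, j). gamma c s i j) ` crossing_pairs m n s"
    unfolding descent_depth_def
    using crossing_pairs_finite crossing_pairs_nonempty[OF adm assms(3)] by (intro Min_in) auto
  then have d: "0 \<le> ?d" using pos by (auto simp: crossing_pairs_def)
  have "0 \<le> gamma c (descend m n c s) i j" if ij: "i \<in> {1..m}" "j \<in> {1..n}" for i j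
  proof (cases "NodeA i \<in> moving_tree s \<and> NodeB j \<notin> moving_tree s")
    case True
    moreover have "NodeB j \<in> fixed_tree s"
      using True assms(2) ij unfolding two_trees_def nodes_def by blast
    ultimately have "(i, j) \<in> crossing_pairs m n s" using ij by (simp add: crossing_pairs_def)
    then have "?d \<le> gamma c s i j"
      unfolding descent_depth_def using crossing_pairs_finite by (intro Min_le) force+
    then show ?thesis using True by (simp add: gamma_descend)
  next
    case False
    then show ?thesis using d pos[OF ij] by (auto simp: gamma_descend)
  qed
  moreover have "gamma c (descend m n c s) i j = 0"
    if ij: "i \<in> {1..m}" "j \<in> {1..n}" and e: "{NodeA i, NodeB j} \<in> edges s" for i j
  proof -
    have "NodeA i \<in> moving_tree s \<longleftrightarrow> NodeB j \<in> moving_tree s"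
      using e component_step[of _ "edges s" NodeQ] by (metis insert_commute)
    then show ?thesis using tight[OF ij e] by (simp add: gamma_descend)
  qed
  ultimately show ?thesis using assms(1) unfolding sound_def by simp
qed

lemma contact_pairs_tight:
  assumes "two_trees m n s" and "(i, j) \<in> contact_pairs m n c s"
  shows "gamma c (descend m n c s) i j = 0"
  using assms two_trees_disjoint by (auto simp: contact_pairs_def crossing_pairs_def gamma_descend)

lemma contact_pairs_nonempty:
  assumes "crossing_pairs m n s \<noteq> {}"
  shows "contact_pairs m n c s \<noteq> {}"
proof -
  have "descent_depth m n c s \<in> (\<lambda>(i, j). gamma c s i j) ` crossing_pairs m n s"
    unfolding descent_depth_def using assms crossing_pairs_finite by (intro Min_in) auto
  then show ?thesis by (force simp: contact_pairs_def)
qed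

lemma add_contact_invariants:
  assumes "sound m n a b c s" and "two_trees m n s"
    and "(i, j) \<in> crossing_pairs m n s" and "gamma c s i j = 0"
  shows "sound m n a b c (add_contact i j s)" and "nodes m n \<subseteq> moving_tree (add_contact i j s)"
proof -
  let ?e = "{NodeA i, NodeB j}" and ?t = "add_contact i j s"
  have ij: "i \<in> {1..m}" "j \<in> {1..n}" "NodeA i \<in> moving_tree s" "NodeB j \<in> fixed_tree s"
    using assms(3) by (auto simp: crossing_pairs_def)
  have B: "NodeB j \<notin> moving_tree s" using two_trees_disjoint[OF assms(2) ij(4)] .
  have e: "?e \<notin> edges s" using B ij(3) component_step by blast
  have [simp]: "edges ?t = insert ?e (edges s)" "force ?t = (force s)(?e := 0)"
    "gamma c ?t = gamma c s"
    by (simp_all add: add_contact_def gamma_def fun_eq_iff)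
  have load: "load ?t x = load s x" for x
  proof -
    have "load ?t x = (\<Sum>f\<in>{f \<in> edges s. x \<in> f}. force ?t f)"
      unfolding load_def
      using finite_edges[OF assms(1)] by (intro sum.mono_neutral_right) auto
    also have "\<dots> = load s x" unfolding load_def using e by (intro sum.cong) auto
    finally show ?thesis .
  qed
  have "forest (insert ?e (edges s))"
    using assms(1) B ij(3) by (intro forest_insert) (auto simp: sound_def intro: component_trans)
  moreover have "?e \<in> admissible_edges m n" using ij by (auto simp: admissible_edges_def)
  ultimately show "sound m n a b c ?t"
    using assms(1,4) e unfolding sound_def load by (auto simp: doubleton_eq_iff)
  have mono: "component (edges s) r \<subseteq> component (edges ?t) r" for r by (rule component_mono) auto
  have "NodeB j \<in> moving_tree ?t"
    by (rule component_step[of "NodeA i"]) (use mono ij(3) in auto)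
  moreover have "NodeP \<in> component (edges ?t) (NodeB j)" using component_sym[OF ij(4)] mono by blast
  ultimately have "NodeP \<in> moving_tree ?t" by (blast intro: component_trans)
  then have "fixed_tree s \<subseteq> moving_tree ?t" using mono by (blast intro: component_trans)
  then show "nodes m n \<subseteq> moving_tree ?t"
    using assms(2) mono[of NodeQ] unfolding two_trees_def by blast
qed

text \<open>Disjointness of odd and even edges is what makes the selected edge end with force \<open>0\<close>, so
  that its deletion changes no sum of forces.\<close>

lemma readjust_invariants:
  assumes "sound m n a b c s" and "main_path (edges s) p"
  shows "sound m n a b c (readjust p s)" and "minimal_edges s p \<noteq> {}"
    and "\<And>e. e \<in> minimal_edges s p \<Longrightarrow> force (readjust p s) e = 0 \<and> breakable (edges s) e"
proof -
  let ?r = "readjustment s p" and ?t = "readjust p s"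
  have p: "distinct p" "hd p = NodeQ" "last p = NodeP" "set (path_edges p) \<subseteq> edges s"
    using assms(2) by (auto simp: main_path_def)
  have adm: "edges s \<subseteq> admissible_edges m n" and fo: "forest (edges s)"
    and pos: "\<And>e. e \<in> edges s \<Longrightarrow> 0 \<le> force s e"
    using assms(1) by (auto simp: sound_def)
  have odd: "odd_edges p \<subseteq> edges s" using odd_even_union[of p] p(4) by auto
  have disj: "odd_edges p \<inter> even_edges p = {}" using odd_even_disjoint[OF p(1)] .
  have "?r \<in> force s ` odd_edges p" unfolding readjustment_def
    using finite_odd_edges odd_edges_nonempty[OF assms(2)] by (intro Min_in) auto
  then obtain e0 where e0: "e0 \<in> odd_edges p" "?r = force s e0" by auto
  then show "minimal_edges s p \<noteq> {}" by (auto simp: minimal_edges_def)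
  have r: "0 \<le> ?r" using e0 odd pos by auto
  have min: "?r \<le> force s e" if "e \<in> odd_edges p" for e
    unfolding readjustment_def using that finite_odd_edges by (intro Min_le) auto
  have [simp]: "edges ?t = edges s" "gamma c ?t = gamma c s"
    by (simp_all add: readjust_def gamma_def fun_eq_iff)
  \<comment> \<open>The double negation is the form required by \<open>alternating_sum_telescopes\<close> at \<open>- ?r\<close>.\<close>
  have force: "force ?t e = force s e +
    (if e \<in> odd_edges p then - ?r else if e \<in> even_edges p then - (- ?r) else 0)" for e
    using disj by (auto simp: readjust_def)
  have load: "load ?t x = load s x" if "x \<noteq> NodeQ" "x \<noteq> NodeP" for x
    using alternating_sum_telescopes[OF finite_edges[OF assms(1)] p(4,1), of x "- ?r"] that p
    unfolding load_def force sum.distrib by simp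
  have "0 \<le> force ?t e" if "e \<in> edges s" for e
    using pos[OF that] r min[of e] by (simp add: force)
  then show "sound m n a b c ?t" using assms(1) unfolding sound_def by (simp add: load)
  fix e assume e: "e \<in> minimal_edges s p"
  then have "force ?t e = 0" by (simp add: force minimal_edges_def)
  moreover have "breakable (edges s) e"
    using e adm admissible_bipartite
    by (intro odd_edge_breakable[OF fo assms(2)]) (auto simp: minimal_edges_def)
  ultimately show "force ?t e = 0 \<and> breakable (edges s) e" ..
qed

lemma delete_edge_invariants:
  assumes "sound m n a b c s" and "nodes m n \<subseteq> moving_tree s"
    and "force s e = 0" and "breakable (edges s) e"
  shows "sound m n a b c (delete_edge e s)" and "two_trees m n (delete_edge e s)"
proof -
  let ?t = "delete_edge e s" and ?F = "edges s - {e}"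
  have [simp]: "edges ?t = ?F" "force ?t = force s" "gamma c ?t = gamma c s"
    by (simp_all add: delete_edge_def gamma_def fun_eq_iff)
  have load: "load ?t x = load s x" for x
    unfolding load_def using finite_edges[OF assms(1)] assms(3)
    by (intro sum.mono_neutral_cong_left) auto
  show "sound m n a b c ?t"
    using assms(1) forest_subset[of "edges s" ?F] unfolding sound_def load by auto
  obtain u v where e: "e = {u, v}" "e \<in> edges s" and u: "u \<in> component ?F NodeQ"
    and v: "v \<notin> component ?F NodeQ" "v \<in> component ?F NodeP"
    using assms(4) by (auto simp: breakable_def)
  have "NodeP \<notin> component ?F NodeQ" using v by (meson component_trans)
  moreover have "x \<in> component ?F NodeQ \<union> component ?F NodeP" if "x \<in> nodes m n" for x
  proof -
    have "insert {u, v} ?F = edges s" using e by auto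
    then have "x \<in> component (insert {u, v} ?F) NodeQ" using that assms(2) by auto
    then have "x \<in> component ?F NodeQ \<or> x \<in> component ?F v"
      using component_insert v(1) by blast
    then show ?thesis using v(2) by (blast intro: component_trans)
  qed
  ultimately show "two_trees m n ?t" by (auto simp: two_trees_def)
qed

lemma initial_forest: "forest ({{NodeQ, NodeA i} | i. i \<in> I} \<union> {{NodeP, NodeB j} | j. j \<in> J})"
  (is "forest ?E")
  unfolding forest_def
proof (intro allI impI)
  fix u v assume uv: "{u, v} \<in> ?E"
  let ?F = "?E - {{u, v}}"
  have leaf: "component ?F l = {l}" if "l \<in> {u, v}" "l \<noteq> NodeQ" "l \<noteq> NodeP" for l
  proof (rule ccontr)
    assume "component ?F l \<noteq> {l}"
    then obtain y where "{l, y} \<in> ?F" by (rule component_first_edge)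
    then show False using that uv by (auto simp: doubleton_eq_iff)
  qed
  show "v \<notin> component ?F u"
  proof
    assume v: "v \<in> component ?F u"
    have "u \<noteq> v" using uv by (auto simp: doubleton_eq_iff)
    moreover have "u \<notin> {NodeQ, NodeP} \<or> v \<notin> {NodeQ, NodeP}" using uv by (auto simp: doubleton_eq_iff)
    ultimately show False using leaf v component_sym[OF v] by auto
  qed
qed

lemma initial_invariants:
  assumes "transportation_data m n a b" and "initial_state m n a b c s"
  shows "sound m n a b c s" and "two_trees m n s" and "\<not> stop_condition s"
proof -
  have mn: "1 \<le> m" "1 \<le> n" and ab: "\<And>i. i \<in> {1..m} \<Longrightarrow> 0 \<le> a i" "\<And>j. j \<in> {1..n} \<Longrightarrow> 0 \<le> b j"
    using assms(1) by (auto simp: transportation_data_def)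
  have E: "edges s = {{NodeQ, NodeA i} | i. i \<in> {1..m}} \<union> {{NodeP, NodeB j} | j. j \<in> {1..n}}"
    and fa: "\<And>i. i \<in> {1..m} \<Longrightarrow> force s {NodeQ, NodeA i} = a i"
    and fb: "\<And>j. j \<in> {1..n} \<Longrightarrow> force s {NodeP, NodeB j} = b j"
    and be: "\<And>j. j \<in> {1..n} \<Longrightarrow> beta s j = 0"
    using assms(2) by (auto simp: initial_state_def)
  obtain csup where csup: "csup > Max {c i j | i j. i \<in> {1..m} \<and> j \<in> {1..n}}"
    and al: "\<And>i. i \<in> {1..m} \<Longrightarrow> alpha s i = csup"
    using assms(2) by (auto simp: initial_state_def)
  have "finite {c i j | i j. i \<in> {1..m} \<and> j \<in> {1..n}}"
    by (rule finite_subset[of _ "(\<lambda>(i, j). c i j) ` ({1..m} \<times> {1..n})"]) auto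
  then have "c i j \<le> Max {c i j | i j. i \<in> {1..m} \<and> j \<in> {1..n}}" if "i \<in> {1..m}" "j \<in> {1..n}" for i j
    using that by (intro Max_ge) auto
  then have gam: "0 \<le> gamma c s i j" if "i \<in> {1..m}" "j \<in> {1..n}" for i j
    using that csup al be unfolding gamma_def by fastforce
  have "{e \<in> edges s. NodeA i \<in> e} = {{NodeQ, NodeA i}}" if "i \<in> {1..m}" for i
    using that unfolding E by auto
  then have la: "load s (NodeA i) = a i" if "i \<in> {1..m}" for i
    using that fa by (simp add: load_def)
  have "{e \<in> edges s. NodeB j \<in> e} = {{NodeP, NodeB j}}" if "j \<in> {1..n}" for j
    using that unfolding E by auto
  then have lb: "load s (NodeB j) = b j" if "j \<in> {1..n}" for j
    using that fb by (simp add: load_def)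
  have "forest (edges s)" unfolding E by (rule initial_forest)
  moreover have "edges s \<subseteq> admissible_edges m n" unfolding E admissible_edges_def by blast
  moreover have "0 \<le> force s e" if "e \<in> edges s" for e using that fa fb ab unfolding E by auto
  moreover have "{NodeA i, NodeB j} \<notin> edges s" for i j unfolding E by (auto simp: doubleton_eq_iff)
  ultimately show "sound m n a b c s" using la lb gam unfolding sound_def by blast
  have star: "x \<in> insert NodeQ (range NodeA)" if "x \<in> moving_tree s" for x
    using that by (induction rule: component_induct) (auto simp: E doubleton_eq_iff)
  have QA: "NodeA i \<in> moving_tree s" if "i \<in> {1..m}" for i
    using that by (intro component_edge) (auto simp: E)
  have PB: "NodeB j \<in> fixed_tree s" if "j \<in> {1..n}" for j
    using that by (intro component_edge) (auto simp: E)
  show "two_trees m n s" using star[of NodeP] QA PB by (auto simp: two_trees_def nodes_def)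
  show "\<not> stop_condition s" using QA[of 1] PB[of 1] mn by (auto simp: stop_condition_def)
qed

section \<open>Optimality of the final flow\<close>

lemma load_A:
  assumes "edges s \<subseteq> admissible_edges m n"
  shows "load s (NodeA i) = (if {NodeQ, NodeA i} \<in> edges s then force s {NodeQ, NodeA i} else 0)
    + (\<Sum>j=1..n. final_flow s i j)"
proof -
  let ?X = "insert {NodeQ, NodeA i} ((\<lambda>j. {NodeA i, NodeB j}) ` {1..n})"
  have "load s (NodeA i) = (\<Sum>e\<in>?X. if e \<in> edges s then force s e else 0)"
    unfolding load_def using assms
    by (intro sum.mono_neutral_cong_left) (auto simp: admissible_edges_def)
  also have "\<dots> = (if {NodeQ, NodeA i} \<in> edges s then force s {NodeQ, NodeA i} else 0) +
    (\<Sum>e\<in>(\<lambda>j. {NodeA i, NodeB j}) ` {1..n}. if e \<in> edges s then force s e else 0)"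
    by (intro sum.insert) (auto simp: doubleton_eq_iff)
  also have "(\<Sum>e\<in>(\<lambda>j. {NodeA i, NodeB j}) ` {1..n}. if e \<in> edges s then force s e else 0)
    = (\<Sum>j=1..n. final_flow s i j)"
    by (subst sum.reindex) (auto simp: inj_on_def doubleton_eq_iff final_flow_def)
  finally show ?thesis .
qed

lemma load_B:
  assumes "edges s \<subseteq> admissible_edges m n"
  shows "load s (NodeB j) = (if {NodeP, NodeB j} \<in> edges s then force s {NodeP, NodeB j} else 0)
    + (\<Sum>i=1..m. final_flow s i j)"
proof -
  let ?X = "insert {NodeP, NodeB j} ((\<lambda>i. {NodeA i, NodeB j}) ` {1..m})"
  have "load s (NodeB j) = (\<Sum>e\<in>?X. if e \<in> edges s then force s e else 0)"
    unfolding load_def using assms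
    by (intro sum.mono_neutral_cong_left) (auto simp: admissible_edges_def)
  also have "\<dots> = (if {NodeP, NodeB j} \<in> edges s then force s {NodeP, NodeB j} else 0) +
    (\<Sum>e\<in>(\<lambda>i. {NodeA i, NodeB j}) ` {1..m}. if e \<in> edges s then force s e else 0)"
    by (intro sum.insert) (auto simp: doubleton_eq_iff)
  also have "(\<Sum>e\<in>(\<lambda>i. {NodeA i, NodeB j}) ` {1..m}. if e \<in> edges s then force s e else 0)
    = (\<Sum>i=1..m. final_flow s i j)"
    by (subst sum.reindex) (auto simp: inj_on_def doubleton_eq_iff final_flow_def)
  finally show ?thesis .
qed

lemma final_flow_feasible:
  assumes data: "transportation_data m n a b" and "sound m n a b c s" and "stop_condition s"
  shows "feasible m n a b (final_flow s)"
proof -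
  let ?f = "final_flow s"
  define p where "p i = (if {NodeQ, NodeA i} \<in> edges s then force s {NodeQ, NodeA i} else 0)" for i
  define q where "q j = (if {NodeP, NodeB j} \<in> edges s then force s {NodeP, NodeB j} else 0)" for j
  have adm: "edges s \<subseteq> admissible_edges m n" and pos: "\<And>e. e \<in> edges s \<Longrightarrow> 0 \<le> force s e"
    using assms(2) by (auto simp: sound_def)
  have A: "a i = p i + (\<Sum>j=1..n. ?f i j)" if "i \<in> {1..m}" for i
    using assms(2) that load_A[OF adm, of i] by (simp add: sound_def p_def)
  have B: "b j = q j + (\<Sum>i=1..m. ?f i j)" if "j \<in> {1..n}" for j
    using assms(2) that load_B[OF adm, of j] by (simp add: sound_def q_def)
  have p0: "0 \<le> p i" and q0: "0 \<le> q i" for i using pos by (auto simp: p_def q_def)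
  have "(\<Sum>i=1..m. a i) = (\<Sum>i=1..m. p i) + (\<Sum>i=1..m. \<Sum>j=1..n. ?f i j)"
    using A by (simp add: sum.distrib)
  moreover have "(\<Sum>j=1..n. b j) = (\<Sum>j=1..n. q j) + (\<Sum>i=1..m. \<Sum>j=1..n. ?f i j)"
    using B by (subst sum.swap) (simp add: sum.distrib)
  ultimately have pq: "(\<Sum>i=1..m. p i) = (\<Sum>j=1..n. q j)"
    using data by (simp add: transportation_data_def)
  have "moving_tree s = {NodeQ} \<Longrightarrow> p i = 0" for i
    unfolding p_def using component_edge[of NodeQ "NodeA i" "edges s"] by auto
  moreover have "fixed_tree s = {NodeP} \<Longrightarrow> q j = 0" for j
    unfolding q_def using component_edge[of NodeP "NodeB j" "edges s"] by auto
  ultimately have "(\<Sum>i=1..m. p i) = 0 \<or> (\<Sum>j=1..n. q j) = 0"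
    using assms(3) unfolding stop_condition_def by (meson sum.neutral)
  then have "(\<Sum>i=1..m. p i) = 0" "(\<Sum>j=1..n. q j) = 0" using pq by auto
  then have "\<forall>i\<in>{1..m}. p i = 0" "\<forall>j\<in>{1..n}. q j = 0"
    using p0 q0 by (simp_all add: sum_nonneg_eq_0_iff)
  then show ?thesis unfolding feasible_def using A B pos by (auto simp: final_flow_def)
qed

text \<open>Weak duality with its slack made explicit: the right-hand side is the same for all
  feasible \<open>f\<close>.\<close>

lemma potential_objective:
  assumes "feasible m n a b f"
  shows "objective m n c f + (\<Sum>i=1..m. \<Sum>j=1..n. gamma c s i j * f i j)
    = (\<Sum>i=1..m. alpha s i * a i) - (\<Sum>j=1..n. beta s j * b j)"
proof -
  have "objective m n c f + (\<Sum>i=1..m. \<Sum>j=1..n. gamma c s i j * f i j)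
    = (\<Sum>i=1..m. \<Sum>j=1..n. alpha s i * f i j) - (\<Sum>i=1..m. \<Sum>j=1..n. beta s j * f i j)"
    unfolding objective_def gamma_def
    by (simp add: sum.distrib[symmetric] sum_subtractf[symmetric] algebra_simps)
  also have "(\<Sum>i=1..m. \<Sum>j=1..n. alpha s i * f i j) = (\<Sum>i=1..m. alpha s i * a i)"
    using assms by (simp add: feasible_def sum_distrib_left[symmetric])
  also have "(\<Sum>i=1..m. \<Sum>j=1..n. beta s j * f i j) = (\<Sum>j=1..n. beta s j * b j)"
    using assms by (subst sum.swap) (simp add: feasible_def sum_distrib_left[symmetric])
  finally show ?thesis .
qed

lemma final_flow_optimal:
  assumes "transportation_data m n a b" and "sound m n a b c s" and "stop_condition s"
  shows "optimal_solution m n a b c (final_flow s)"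
proof -
  have feas: "feasible m n a b (final_flow s)" using final_flow_feasible[OF assms] .
  have "gamma c s i j * final_flow s i j = 0" if "i \<in> {1..m}" "j \<in> {1..n}" for i j
    using assms(2) that by (auto simp: sound_def final_flow_def)
  then have zero: "(\<Sum>i=1..m. \<Sum>j=1..n. gamma c s i j * final_flow s i j) = 0"
    by (intro sum.neutral ballI) auto
  have "objective m n c g \<le> objective m n c (final_flow s)" if g: "feasible m n a b g" for g
  proof -
    have "0 \<le> (\<Sum>i=1..m. \<Sum>j=1..n. gamma c s i j * g i j)"
      using assms(2) g by (intro sum_nonneg) (auto simp: sound_def feasible_def)
    then show ?thesis
      using potential_objective[OF g, of c s] potential_objective[OF feas, of c s] zero by linarith
  qed
  then show ?thesis using feas by (simp add: optimal_solution_def)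
qed

section \<open>Runs of the algorithm\<close>

fun run_invariant ::
    "nat \<Rightarrow> nat \<Rightarrow> (nat \<Rightarrow> real) \<Rightarrow> (nat \<Rightarrow> real) \<Rightarrow> (nat \<Rightarrow> nat \<Rightarrow> real) \<Rightarrow> config \<Rightarrow> bool" where
  "run_invariant m n a b c (At_Descent s) \<longleftrightarrow>
     sound m n a b c s \<and> two_trees m n s \<and> \<not> stop_condition s"
| "run_invariant m n a b c (At_Contact s K) \<longleftrightarrow>
     sound m n a b c s \<and> two_trees m n s \<and> K \<noteq> {} \<and>
     (\<forall>(i, j)\<in>K. (i, j) \<in> crossing_pairs m n s \<and> gamma c s i j = 0)"
| "run_invariant m n a b c (At_Readjustment s) \<longleftrightarrow>
     sound m n a b c s \<and> nodes m n \<subseteq> moving_tree s"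
| "run_invariant m n a b c (At_Breaking s M) \<longleftrightarrow>
     sound m n a b c s \<and> nodes m n \<subseteq> moving_tree s \<and> M \<noteq> {} \<and>
     (\<forall>e\<in>M. force s e = 0 \<and> breakable (edges s) e)"
| "run_invariant m n a b c (Terminated s) \<longleftrightarrow> sound m n a b c s \<and> stop_condition s"

lemma run_invariant_step:
  assumes "step m n c x y" and "run_invariant m n a b c x"
  shows "run_invariant m n a b c y"
  using assms
proof cases
  case (descent s)
  then have s: "sound m n a b c s" "two_trees m n s" "\<not> stop_condition s" using assms(2) by auto
  have "contact_pairs m n c s \<noteq> {}"
    using s crossing_pairs_nonempty contact_pairs_nonempty by (auto simp: sound_def)
  moreover have "two_trees m n (descend m n c s)" using s(2) by (simp add: two_trees_def)
  moreover have "contact_pairs m n c s \<subseteq> crossing_pairs m n s" by (auto simp: contact_pairs_def)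
  ultimately show ?thesis
    using descent descend_sound[OF s] contact_pairs_tight[OF s(2)] by auto
next
  case (contact i j K s)
  then show ?thesis using assms(2) add_contact_invariants[of m n a b c s i j] by auto
next
  case (readjustment s p)
  then show ?thesis using assms(2) readjust_invariants[of m n a b c s p] by (auto simp: readjust_def)
next
  case (breaking_continue e M s)
  then show ?thesis using assms(2) delete_edge_invariants[of m n a b c s e] by auto
next
  case (breaking_stop e M s)
  then show ?thesis using assms(2) delete_edge_invariants[of m n a b c s e] by auto
qed

lemma run_invariant_run:
  "(step m n c)\<^sup>*\<^sup>* x y \<Longrightarrow> run_invariant m n a b c x \<Longrightarrow> run_invariant m n a b c y"
  by (induction rule: rtranclp_induct) (auto intro: run_invariant_step)

lemma run_progress:
  assumes "run_invariant m n a b c x"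
  shows "(\<exists>s. x = Terminated s) \<or> (\<exists>y. step m n c x y)"
proof (cases x)
  case (At_Descent s) then show ?thesis by (auto intro: step.descent)
next
  case (At_Contact s K)
  then obtain i j where "(i, j) \<in> K" using assms by auto
  then show ?thesis using At_Contact by (auto intro: step.contact)
next
  case (At_Readjustment s)
  then have "NodeP \<in> moving_tree s" using assms by (auto simp: nodes_def)
  then show ?thesis using At_Readjustment main_path_exists by (blast intro: step.readjustment)
next
  case (At_Breaking s M)
  then obtain e where "e \<in> M" using assms by auto
  then show ?thesis using At_Breaking by (blast intro: step.breaking_continue step.breaking_stop)
qed auto

text \<open>The fifth step only excludes that the cycle is the last one.\<close>

lemma cycle_exchange:
  assumes inv: "run_invariant m n a b c (At_Descent s)"
    and steps: "step m n c (At_Descent s) x1" "step m n c x1 x2" "step m n c x2 x3"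
      "step m n c x3 x4" "step m n c x4 x5"
  obtains s' where "x4 = At_Descent s'" and "exchange (edges s) (edges s')"
proof -
  define d where "d = descend m n c s"
  have x1: "x1 = At_Contact d (contact_pairs m n c s)"
    using steps(1) by cases (simp add: d_def)
  obtain i j where ij: "(i, j) \<in> contact_pairs m n c s" and x2: "x2 = At_Readjustment (add_contact i j d)"
    using steps(2) unfolding x1 by cases auto
  define t where "t = add_contact i j d"
  obtain p where p: "main_path (edges t) p" and x3: "x3 = At_Breaking (readjust p t) (minimal_edges t p)"
    using steps(3) unfolding x2 t_def[symmetric] by cases auto
  obtain e where e: "e \<in> minimal_edges t p"
    and x4: "x4 = At_Descent (delete_edge e (readjust p t)) \<or> x4 = Terminated (delete_edge e (readjust p t))"
    using steps(4) unfolding x3 by cases auto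
  have "\<not> step m n c (Terminated r) x5" for r by (auto elim: step.cases)
  then have x4: "x4 = At_Descent (delete_edge e (readjust p t))" using x4 steps(5) by auto
  have "run_invariant m n a b c x3"
    using run_invariant_step[OF steps(3) run_invariant_step[OF steps(2) run_invariant_step[OF steps(1) inv]]] .
  then have "breakable (edges t) e" using e by (simp add: x3 readjust_def)
  moreover have t: "edges t = insert {NodeA i, NodeB j} (edges s)"
    by (simp add: t_def d_def add_contact_def)
  moreover have "edges (delete_edge e (readjust p t)) = edges t - {e}"
    by (simp add: delete_edge_def readjust_def)
  moreover have "NodeA i \<in> moving_tree s" "NodeB j \<notin> moving_tree s"
    using ij inv two_trees_disjoint by (auto simp: contact_pairs_def crossing_pairs_def)
  ultimately have "exchange (edges s) (edges (delete_edge e (readjust p t)))"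
    unfolding exchange_def exchange_by_def breakable_def by auto
  then show ?thesis using that x4 by blast
qed

lemma no_infinite_run:
  assumes inv: "run_invariant m n a b c (At_Descent s0)"
    and start: "r 0 = At_Descent s0" and steps: "\<And>k. step m n c (r k) (r (Suc k))"
  shows False
proof -
  have inv_r: "run_invariant m n a b c (r k)" for k
  proof (induction k)
    case 0 show ?case using inv start by simp
  next
    case (Suc k) show ?case using run_invariant_step[OF steps Suc.IH] .
  qed
  \<comment> \<open>Four steps make up one cycle, so the descents occur at the multiples of 4.\<close>
  have cycle: "\<exists>s'. r (4 * Suc k) = At_Descent s' \<and> exchange (edges s) (edges s')"
    if s: "r (4 * k) = At_Descent s" for k s
  proof -
    have "run_invariant m n a b c (At_Descent s)" using inv_r[of "4 * k"] s by simp
    moreover have "step m n c (At_Descent s) (r (Suc (4 * k)))" using steps[of "4 * k"] s by simp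
    ultimately show ?thesis
      using cycle_exchange[of m n a b c s, OF _ _ steps steps steps steps] by (auto simp: eval_nat_numeral)
  qed
  have "\<exists>s. r (4 * k) = At_Descent s" for k
    by (induction k) (use start cycle in auto)
  then obtain s where s: "\<And>k. r (4 * k) = At_Descent (s k)" by metis
  have "exchange (edges (s k)) (edges (s (Suc k)))" for k
    using cycle[OF s[of k]] s[of "Suc k"] by auto
  moreover have "edges (s k) \<subseteq> admissible_edges m n" for k
    using inv_r[of "4 * k"] s[of k] by (simp add: sound_def)
  ultimately show False
    using no_infinite_exchange[OF finite_admissible, of "\<lambda>k. edges (s k)" m n] by blast
qed

theorem mainTheorem3:
  fixes m n :: nat and a b :: "nat \<Rightarrow> real" and c :: "nat \<Rightarrow> nat \<Rightarrow> real"
    and s0 :: state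
  assumes "transportation_data m n a b"
    and "initial_state m n a b c s0"
  shows "always_terminates m n c (At_Descent s0) \<and>
    (\<forall>s. (step m n c)\<^sup>*\<^sup>* (At_Descent s0) (Terminated s) \<longrightarrow>
       optimal_solution m n a b c (final_flow s))"
proof (intro conjI allI impI)
  have inv: "run_invariant m n a b c (At_Descent s0)"
    using initial_invariants[OF assms] by simp
  show "always_terminates m n c (At_Descent s0)"
    unfolding always_terminates_def
    using no_infinite_run[OF inv] run_progress run_invariant_run[OF _ inv] by blast
  fix s assume "(step m n c)\<^sup>*\<^sup>* (At_Descent s0) (Terminated s)"
  then have "run_invariant m n a b c (Terminated s)" using inv by (rule run_invariant_run)
  then show "optimal_solution m n a b c (final_flow s)"
    using final_flow_optimal[OF assms(1)] by simp
qed

end
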